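(* Let $\mathfrak{A}$ be an infinite UHF C$^*$-algebra (i.e. not a matrix algebra), and let $\mathfrak{D}$ be the diagonal subalgebra of $\mathfrak{A}$ with corresponding conditional expectation $E:\mathfrak{A}\to\mathfrak{D}$. Let $\{A_k\}_{k=1}^n$ be a partition of unity in $\mathfrak{D}$. Then for each $\epsilon>0$ there exists a collection of non-zero pairwise orthogonal projections $\{P_k\}_{k=1}^n\subseteq\mathfrak{A}$ such that $\sum_{k=1}^n P_k=I_{\mathfrak{A}}$ and \[ \|E(P_k)-A_k\|<\epsilon \] for all $k$.
   Context: A partition of unity in a unital algebra $\mathfrak{N}$ is a finite collection $\{A_k\}_{k=1}^n\subseteq\mathfrak{N}$ with $0\le A_k\le I$ for all $k$ and $\sum_{k=1}^n A_k=I$. A UHF C$^*$-algebra is the inductive limit of a sequence of unital embeddings of full matrix algebras $\mathbb{C}\hookrightarrow M_{n_1}(\mathbb{C})\hookrightarrow M_{n_2}(\mathbb{C})\hookrightarrow\cdots$, where each embedding is $T\mapsto T\oplus\cdots\oplus T$. Its diagonal subalgebra $\mathfrak{D}$ is the closure of the union of the diagonal subalgebras of the $M_{n_j}(\mathbb{C})$, and $E$ is the conditional expectation extending the maps sending a matrix in $M_{n_j}(\mathbb{C})$ to its diagonal. *)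

theory Defs
  imports "HOL-Analysis.Analysis" "Jordan_Normal_Form.Schur_Decomposition"
begin

section \<open>Unital C*-algebras\<close>

text \<open>The real scalar multiplication and the norm come from the class of unital real Banach
  algebras; the complex structure and the involution are added on top. The superclass
  forces the norm of the unit to be 1, so the zero algebra is excluded.\<close>

class unital_cstar_algebra = real_normed_algebra_1 + complete_space +
  fixes scaleC :: "complex \<Rightarrow> 'a \<Rightarrow> 'a"
    and star :: "'a \<Rightarrow> 'a"
  assumes scaleC_add_right: "scaleC c (x + y) = scaleC c x + scaleC c y"
    and scaleC_add_left: "scaleC (c + d) x = scaleC c x + scaleC d x"
    and scaleC_scaleC: "scaleC c (scaleC d x) = scaleC (c * d) x"
    and scaleC_of_real: "scaleC (complex_of_real r) x = scaleR r x"
    and scaleC_mult_left: "scaleC c x * y = scaleC c (x * y)"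
    and scaleC_mult_right: "x * scaleC c y = scaleC c (x * y)"
    and norm_scaleC: "norm (scaleC c x) = cmod c * norm x"
    and star_star: "star (star x) = x"
    and star_add: "star (x + y) = star x + star y"
    and star_scaleC: "star (scaleC c x) = scaleC (cnj c) (star x)"
    and star_mult: "star (x * y) = star y * star x"
    and norm_star_mult_self: "norm (star x * x) = (norm x)\<^sup>2"

definition invertible_element :: "'a::monoid_mult \<Rightarrow> bool" where
  "invertible_element x \<longleftrightarrow> (\<exists>y. x * y = 1 \<and> y * x = 1)"

definition cstar_spectrum :: "'a::unital_cstar_algebra \<Rightarrow> complex set" where
  "cstar_spectrum x = {c. \<not> invertible_element (scaleC c 1 - x)}"

definition cstar_positive :: "'a::unital_cstar_algebra \<Rightarrow> bool" where
  "cstar_positive x \<longleftrightarrow>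
     star x = x \<and> (\<forall>c\<in>cstar_spectrum x. \<exists>r\<ge>0. c = complex_of_real r)"

definition cstar_le :: "'a::unital_cstar_algebra \<Rightarrow> 'a \<Rightarrow> bool" where
  "cstar_le x y \<longleftrightarrow> cstar_positive (y - x)"

definition projection :: "'a::unital_cstar_algebra \<Rightarrow> bool" where
  "projection p \<longleftrightarrow> p * p = p \<and> star p = p"

text \<open>A collection indexed by 1, ..., m, possibly with repetitions.\<close>

definition partition_of_unity ::
    "'a::unital_cstar_algebra set \<Rightarrow> nat \<Rightarrow> (nat \<Rightarrow> 'a) \<Rightarrow> bool" where
  "partition_of_unity N m A \<longleftrightarrow>
     (\<forall>k\<in>{1..m}. A k \<in> N \<and> cstar_le 0 (A k) \<and> cstar_le (A k) 1) \<and>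
     (\<Sum>k=1..m. A k) = 1"

definition conditional_expectation ::
    "'a::unital_cstar_algebra set \<Rightarrow> ('a \<Rightarrow> 'a) \<Rightarrow> bool" where
  "conditional_expectation D E \<longleftrightarrow>
     (\<forall>x y. E (x + y) = E x + E y) \<and>
     (\<forall>c x. E (scaleC c x) = scaleC c (E x)) \<and>
     (\<forall>x. E x \<in> D) \<and>
     (\<forall>d\<in>D. E d = d) \<and>
     (\<forall>x. norm (E x) \<le> norm x) \<and>
     (\<forall>x. cstar_positive x \<longrightarrow> cstar_positive (E x)) \<and>
     (\<forall>d\<in>D. \<forall>d'\<in>D. \<forall>x. E (d * x * d') = d * E x * d')"


section \<open>Matrix algebras and UHF algebras\<close>

text \<open>Injective unital *-homomorphisms from the full matrix algebra of size N; such maps are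
  automatically isometric for the operator norm on matrices.\<close>

definition matrix_embedding ::
    "nat \<Rightarrow> (complex mat \<Rightarrow> 'a::unital_cstar_algebra) \<Rightarrow> bool" where
  "matrix_embedding N \<phi> \<longleftrightarrow>
     (\<forall>S\<in>carrier_mat N N. \<forall>T\<in>carrier_mat N N. \<phi> (S + T) = \<phi> S + \<phi> T) \<and>
     (\<forall>c. \<forall>T\<in>carrier_mat N N. \<phi> (c \<cdot>\<^sub>m T) = scaleC c (\<phi> T)) \<and>
     (\<forall>S\<in>carrier_mat N N. \<forall>T\<in>carrier_mat N N. \<phi> (S * T) = \<phi> S * \<phi> T) \<and>
     (\<forall>T\<in>carrier_mat N N. \<phi> (mat_adjoint T) = star (\<phi> T)) \<and>
     \<phi> (1\<^sub>m N) = 1 \<and>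
     inj_on \<phi> (carrier_mat N N)"

definition is_matrix_algebra :: "'a::unital_cstar_algebra itself \<Rightarrow> bool" where
  "is_matrix_algebra _ \<longleftrightarrow>
     (\<exists>N>0. \<exists>\<psi> :: complex mat \<Rightarrow> 'a.
        matrix_embedding N \<psi> \<and> \<psi> ` carrier_mat N N = UNIV)"

definition amplification :: "nat \<Rightarrow> complex mat \<Rightarrow> complex mat" where
  "amplification d T = diag_block_mat (replicate d T)"

text \<open>The algebra \<open>'a\<close> is the C*-inductive limit of the matrix algebras of sizes
  \<open>n 0 = 1, n 1, n 2, \<dots>\<close> along the connecting maps \<open>T \<mapsto> T \<oplus> \<dots> \<oplus> T\<close>, where \<open>\<phi> j\<close> is
  the canonical map of the j-th matrix algebra into the limit. As the connecting maps are
  injective, so are the canonical maps, and the limit is the norm closure of the union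
  of their ranges.\<close>

definition uhf_system ::
    "(nat \<Rightarrow> nat) \<Rightarrow> (nat \<Rightarrow> complex mat \<Rightarrow> 'a::unital_cstar_algebra) \<Rightarrow> bool" where
  "uhf_system n \<phi> \<longleftrightarrow>
     n 0 = 1 \<and>
     (\<forall>j. 0 < n j \<and> n j dvd n (Suc j)) \<and>
     (\<forall>j. matrix_embedding (n j) (\<phi> j)) \<and>
     (\<forall>j. \<forall>T\<in>carrier_mat (n j) (n j).
        \<phi> (Suc j) (amplification (n (Suc j) div n j) T) = \<phi> j T) \<and>
     closure (\<Union>j. \<phi> j ` carrier_mat (n j) (n j)) = UNIV"

definition uhf_diagonal ::
    "(nat \<Rightarrow> nat) \<Rightarrow> (nat \<Rightarrow> complex mat \<Rightarrow> 'a::unital_cstar_algebra) \<Rightarrow> 'a set" where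
  "uhf_diagonal n \<phi> =
     closure (\<Union>j. \<phi> j ` {T \<in> carrier_mat (n j) (n j). diagonal_mat T})"

definition diag_part :: "complex mat \<Rightarrow> complex mat" where
  "diag_part T = mat (dim_row T) (dim_col T) (\<lambda>(i, j). if i = j then T $$ (i, j) else 0)"

text \<open>The ranges of the \<open>\<phi> j\<close> have dense union, so the last condition together
  with contractivity determines the map uniquely.\<close>

definition uhf_expectation ::
    "(nat \<Rightarrow> nat) \<Rightarrow> (nat \<Rightarrow> complex mat \<Rightarrow> 'a::unital_cstar_algebra) \<Rightarrow> ('a \<Rightarrow> 'a) \<Rightarrow> bool"
  where
  "uhf_expectation n \<phi> E \<longleftrightarrow>
     conditional_expectation (uhf_diagonal n \<phi>) E \<and>
     (\<forall>j. \<forall>T\<in>carrier_mat (n j) (n j). E (\<phi> j T) = \<phi> j (diag_part T))"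

end

(*
  Every index i gives a character of the diagonal algebra, namely the (i,i) entry at all
  sufficiently high levels. Its value at A_k lies in the spectrum of A_k, so the A_k are
  approximated at some level j by diagonal matrices with nonnegative entries a_k(i) whose
  sum over k is 1 for every i. At a much higher level the position i occurs d times, and the
  corresponding corner is M_d. There the projections onto the spans of disjoint sets of
  r_k(i) Fourier basis vectors, one set for each k, have constant diagonal r_k(i)/d,
  because all entries of the Fourier matrix have the same modulus. Choosing r_k(i) >= 1 with
  r_k(i)/d close to a_k(i) gives the projections P_k.
*)

theory Submission
  imports Defs
begin

section \<open>Complex scalars and norms of projections\<close>

lemma scaleC_zero_left [simp]: "scaleC 0 (x::'a::unital_cstar_algebra) = 0"
  using norm_scaleC[of 0 x] by simp

lemma scaleC_one [simp]: "scaleC 1 (x::'a::unital_cstar_algebra) = x"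
  using scaleC_of_real[of 1 x] by simp

lemma scaleC_minus_left: "scaleC (- c) (x::'a::unital_cstar_algebra) = - scaleC c x"
  using scaleC_add_left[of "- c" c x] by (simp add: eq_neg_iff_add_eq_0)

lemma scaleC_diff_left: "scaleC (c - d) (x::'a::unital_cstar_algebra) = scaleC c x - scaleC d x"
  using scaleC_add_left[of c "- d" x] by (simp add: scaleC_minus_left)

text \<open>For a projection the C*-identity reads \<open>(norm p)^2 = norm p\<close>. It makes the
  diagonal matrix units norm-one elements, which the limit arguments on the diagonal rely
  on.\<close>

lemma norm_projection:
  fixes p :: "'a::unital_cstar_algebra"
  assumes "projection p" "p \<noteq> 0"
  shows "norm p = 1"
proof -
  have "(norm p)\<^sup>2 = norm p"
    using norm_star_mult_self[of p] assms by (simp add: projection_def)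
  then show ?thesis using assms by (simp add: power2_eq_square)
qed


section \<open>Diagonal matrices\<close>

lemma mat_adjoint_dim [simp]:
  "dim_row (mat_adjoint A) = dim_col A" "dim_col (mat_adjoint A) = dim_row A"
  by (auto simp: mat_adjoint_def)

lemma mat_adjoint_carrier: "A \<in> carrier_mat N M \<Longrightarrow> mat_adjoint A \<in> carrier_mat M N"
  by (metis carrier_matD carrier_matI mat_adjoint_dim)

lemma mat_adjoint_index:
  "i < dim_col A \<Longrightarrow> j < dim_row A \<Longrightarrow> mat_adjoint A $$ (i, j) = conjugate (A $$ (j, i))"
  by (auto simp: mat_adjoint_def mat_of_rows_index)

lemma mat_diag_index [simp]:
  "i < N \<Longrightarrow> j < N \<Longrightarrow> mat_diag N f $$ (i, j) = (if i = j then f j else 0)"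
  by (simp add: mat_diag_def)

lemma mat_diag_dims [simp]: "dim_row (mat_diag N f) = N" "dim_col (mat_diag N f) = N"
  by (simp_all add: mat_diag_def)

lemma mat_diag_cong: "(\<And>i. i < N \<Longrightarrow> f i = g i) \<Longrightarrow> mat_diag N f = mat_diag N g"
  by (intro eq_matI) auto

lemma mat_diag_eqI:
  "T \<in> carrier_mat N N \<Longrightarrow> diagonal_mat T \<Longrightarrow> T = mat_diag N (\<lambda>i. T $$ (i, i))"
  by (intro eq_matI) (auto simp: diagonal_mat_def)

lemma mat_diag_diagonal: "diagonal_mat (mat_diag N f)"
  by (auto simp: diagonal_mat_def)

lemma diag_part_eq_mat_diag:
  "T \<in> carrier_mat N N \<Longrightarrow> diag_part T = mat_diag N (\<lambda>i. T $$ (i, i))"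
  by (intro eq_matI) (auto simp: diag_part_def)

lemma mat_adjoint_mat_diag: "mat_adjoint (mat_diag N f) = mat_diag N (\<lambda>i. cnj (f i))"
  by (intro eq_matI) (auto simp: mat_adjoint_index)

lemma mat_diag_add: "mat_diag N f + mat_diag N g = mat_diag N (\<lambda>i. f i + g i :: complex)"
  by (intro eq_matI) auto

lemma mat_diag_smult: "c \<cdot>\<^sub>m mat_diag N f = mat_diag N (\<lambda>i. c * f i :: complex)"
  by (intro eq_matI) auto

text \<open>Position \<open>p\<close> of the direct sum lies in copy number \<open>p div N\<close>,
  at place \<open>p mod N\<close> of that copy. All later constructions use this indexing.\<close>

lemma amplification_mat_diag:
  assumes "0 < N"
  shows "amplification d (mat_diag N f) = mat_diag (d * N) (\<lambda>p. f (p mod N))"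
proof (induction d)
  case 0
  show ?case by (intro eq_matI) (auto simp: amplification_def)
next
  case (Suc d)
  then have *: "diag_block_mat (replicate d (mat_diag N f)) = mat_diag (d * N) (\<lambda>p. f (p mod N))"
    by (simp add: amplification_def)
  show ?case
    unfolding amplification_def
    by (intro eq_matI) (auto simp: * Let_def le_mod_geq)
qed

lemma amplification_carrier:
  assumes "T \<in> carrier_mat N N"
  shows "amplification d T \<in> carrier_mat (d * N) (d * N)"
  using assms
  by (intro carrier_matI) (auto simp: amplification_def dim_diag_block_mat sum_list_replicate)


section \<open>Representations of matrix algebras\<close>

locale matrix_representation =
  fixes N :: nat and \<phi> :: "complex mat \<Rightarrow> 'a::unital_cstar_algebra"
  assumes embedding: "matrix_embedding N \<phi>"
begin

lemma add: "S \<in> carrier_mat N N \<Longrightarrow> T \<in> carrier_mat N N \<Longrightarrow> \<phi> (S + T) = \<phi> S + \<phi> T"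
  and smult: "T \<in> carrier_mat N N \<Longrightarrow> \<phi> (c \<cdot>\<^sub>m T) = scaleC c (\<phi> T)"
  and mult: "S \<in> carrier_mat N N \<Longrightarrow> T \<in> carrier_mat N N \<Longrightarrow> \<phi> (S * T) = \<phi> S * \<phi> T"
  and adjoint: "T \<in> carrier_mat N N \<Longrightarrow> \<phi> (mat_adjoint T) = star (\<phi> T)"
  and one: "\<phi> (1\<^sub>m N) = 1"
  and inj: "inj_on \<phi> (carrier_mat N N)"
  using embedding by (auto simp: matrix_embedding_def)

lemma zero: "\<phi> (0\<^sub>m N N) = 0"
proof -
  have "0\<^sub>m N N = 0 \<cdot>\<^sub>m (0\<^sub>m N N :: complex mat)" by auto
  then show ?thesis using smult[of "0\<^sub>m N N" 0] by simp
qed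

section \<open>Images of diagonal matrices\<close>

definition diag :: "(nat \<Rightarrow> complex) \<Rightarrow> 'a" where
  "diag f = \<phi> (mat_diag N f)"

abbreviation ind :: "nat \<Rightarrow> 'a" where
  "ind i \<equiv> diag (\<lambda>p. of_bool (p = i))"

lemma diag_cong: "(\<And>i. i < N \<Longrightarrow> f i = g i) \<Longrightarrow> diag f = diag g"
  unfolding diag_def by (metis mat_diag_cong)

lemma diag_one: "diag (\<lambda>_. 1) = 1"
  by (simp add: diag_def one)

lemma diag_zero: "diag (\<lambda>_. 0) = 0"
proof -
  have "mat_diag N (\<lambda>_. 0 :: complex) = 0\<^sub>m N N" by (intro eq_matI) auto
  then show ?thesis by (simp add: diag_def zero)
qed

lemma diag_add: "diag (\<lambda>i. f i + g i) = diag f + diag g"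
  by (simp add: diag_def add flip: mat_diag_add)

lemma diag_mult: "diag f * diag g = diag (\<lambda>i. f i * g i)"
  by (simp add: diag_def flip: mult)

lemma diag_scale: "diag (\<lambda>i. c * f i) = scaleC c (diag f)"
  by (simp add: diag_def smult flip: mat_diag_smult)

lemma diag_diff: "diag (\<lambda>i. f i - g i) = diag f - diag g"
  using diag_add[of "\<lambda>i. f i - g i" g] by simp

lemma diag_const: "diag (\<lambda>_. c) = scaleC c 1"
  using diag_scale[of c "\<lambda>_. 1"] by (simp add: diag_one)

lemma diag_star: "star (diag f) = diag (\<lambda>i. cnj (f i))"
  by (simp add: diag_def flip: adjoint mat_adjoint_mat_diag)

lemma diag_sum: "diag (\<lambda>i. \<Sum>k\<in>K. f k i) = (\<Sum>k\<in>K. diag (f k))"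
  by (induction K rule: infinite_finite_induct) (auto simp: diag_add diag_zero)

lemma diag_eq_0_iff: "diag f = 0 \<longleftrightarrow> (\<forall>i<N. f i = 0)"
proof
  assume "diag f = 0"
  then have "mat_diag N f = 0\<^sub>m N N"
    using inj_onD[OF inj, of "mat_diag N f" "0\<^sub>m N N"] by (simp add: diag_def zero)
  then show "\<forall>i<N. f i = 0"
    by (metis index_zero_mat(1) mat_diag_index)
next
  assume "\<forall>i<N. f i = 0"
  then have "diag f = diag (\<lambda>_. 0)" by (intro diag_cong) auto
  then show "diag f = 0" by (simp add: diag_zero)
qed

lemma projection_diag_of_bool: "projection (diag (\<lambda>i. of_bool (Q i)))"
  unfolding projection_def diag_mult diag_star
  by (intro conjI diag_cong) auto

lemma norm_ind: "i < N \<Longrightarrow> norm (ind i) = 1"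
  by (intro norm_projection projection_diag_of_bool) (auto simp: diag_eq_0_iff)

lemma norm_ind_le: "norm (ind i) \<le> 1"
proof (cases "i < N")
  case False
  then have "ind i = 0" by (auto simp: diag_eq_0_iff)
  then show ?thesis by simp
qed (simp add: norm_ind)

lemma diag_eq_sum_ind: "diag f = (\<Sum>i<N. scaleC (f i) (ind i))"
proof -
  have "diag f = diag (\<lambda>p. \<Sum>i<N. f i * of_bool (p = i))"
    by (intro diag_cong) (simp add: of_bool_def if_distrib[of "\<lambda>x. _ * x"] cong: if_cong)
  also have "\<dots> = (\<Sum>i<N. diag (\<lambda>p. f i * of_bool (p = i)))"
    by (rule diag_sum)
  finally show ?thesis by (simp only: diag_scale)
qed

lemma norm_diag_le_sum: "norm (diag f) \<le> (\<Sum>i<N. cmod (f i))"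
proof -
  have "norm (diag f) \<le> (\<Sum>i<N. norm (scaleC (f i) (ind i)))"
    unfolding diag_eq_sum_ind[of f] by (rule norm_sum)
  also have "\<dots> \<le> (\<Sum>i<N. cmod (f i))"
    by (intro sum_mono) (simp add: norm_scaleC mult_left_le norm_ind_le)
  finally show ?thesis .
qed

text \<open>The C*-identity gives \<open>norm (diag f)\<^sup>2 = norm (diag \<bar>f\<bar>\<^sup>2)\<close>, so the crude bound by \<open>N\<close>
  improves to its \<open>2\<^sup>k\<close>-th root for every \<open>k\<close>.\<close>

lemma norm_diag_le_1:
  assumes "\<And>i. i < N \<Longrightarrow> cmod (f i) \<le> 1"
  shows "norm (diag f) \<le> 1"
proof (rule ccontr)
  assume "\<not> ?thesis"
  then have gt: "norm (diag f) > 1" by simp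
  have bound: "(\<forall>i<N. cmod (g i) \<le> 1) \<Longrightarrow> norm (diag g) ^ (2 ^ k) \<le> real N" for g k
  proof (induction k arbitrary: g)
    case 0
    have "norm (diag g) \<le> (\<Sum>i<N. cmod (g i))" by (rule norm_diag_le_sum)
    also have "\<dots> \<le> (\<Sum>i<N. 1)" using 0 by (intro sum_mono) auto
    finally show ?case by simp
  next
    case (Suc k)
    have "norm (diag g) ^ (2 ^ Suc k) = (norm (diag g) ^ 2) ^ (2 ^ k)"
      by (simp add: power_mult)
    also have "\<dots> = norm (diag (\<lambda>i. cnj (g i) * g i)) ^ (2 ^ k)"
      by (simp add: diag_star diag_mult flip: norm_star_mult_self)
    also have "\<dots> \<le> real N"
      using Suc.prems by (intro Suc.IH) (auto simp: norm_mult mult_le_one)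
    finally show ?case .
  qed
  obtain k where "real N < norm (diag f) ^ k"
    using gt real_arch_pow by blast
  also have "\<dots> \<le> norm (diag f) ^ (2 ^ k)"
    using gt by (intro power_increasing) (auto intro: less_imp_le less_exp)
  finally show False using bound[of f k] assms by force
qed

lemma norm_diag_le:
  assumes "\<And>i. i < N \<Longrightarrow> cmod (f i) \<le> c" "0 \<le> c"
  shows "norm (diag f) \<le> c"
proof (cases "c = 0")
  case True
  then have "diag f = 0" using assms by (auto simp: diag_eq_0_iff)
  then show ?thesis using assms by simp
next
  case False
  then have c: "c > 0" using assms by simp
  have "diag f = scaleC (complex_of_real c) (diag (\<lambda>i. f i / c))"
    using c by (simp flip: diag_scale)
  moreover have "norm (diag (\<lambda>i. f i / c)) \<le> 1"
    using assms c by (intro norm_diag_le_1) (auto simp: norm_divide)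
  ultimately show ?thesis using c by (simp add: norm_scaleC mult_left_le)
qed

text \<open>Compressing \<open>x\<close> by matrix units puts each of its entries into the one-dimensional, hence
  closed, space spanned by the first diagonal matrix unit.\<close>

lemma closed_range:
  assumes "0 < N"
  shows "closed (\<phi> ` carrier_mat N N)"
proof -
  define M where "M i j = mat N N (\<lambda>(p, q). if p = i \<and> q = j then 1 else 0 :: complex)" for i j
  define e where "e i j = \<phi> (M i j)" for i j
  have M [simp]: "M i j \<in> carrier_mat N N" for i j by (simp add: M_def)
  have left: "M i j * T = mat N N (\<lambda>(p, q). if p = i then T $$ (j, q) else 0)"
    if "T \<in> carrier_mat N N" "j < N" for i j T
    using that by (intro eq_matI)
      (auto simp: M_def scalar_prod_def if_distrib[of "\<lambda>x. x * _"] cong: if_cong)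
  have MM: "M i j * M k l = (if j = k then M i l else 0\<^sub>m N N)" if "j < N" for i j k l
    using that by (subst left) (auto simp: M_def intro!: eq_matI)
  have MTM: "M i j * T * M k l = T $$ (j, k) \<cdot>\<^sub>m M i l"
    if T: "T \<in> carrier_mat N N" and "j < N" "k < N" for i j k l T
    unfolding left[OF T \<open>j < N\<close>] using that by (intro eq_matI)
      (auto simp: M_def scalar_prod_def if_distrib[of "\<lambda>x. _ * x"] cong: if_cong)
  have ee: "e i j * e k l = (if j = k then e i l else 0)" if "j < N" for i j k l
    using that by (simp add: e_def MM zero flip: mult)
  have eTe: "e i j * \<phi> T * e k l = scaleC (T $$ (j, k)) (e i l)"
    if "T \<in> carrier_mat N N" "j < N" "k < N" for i j k l T
  proof -
    have "e i j * \<phi> T * e k l = \<phi> (M i j * T * M k l)"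
      using that(1) by (simp add: e_def mult mult_carrier_mat[of _ N N])
    then show ?thesis using that by (simp add: MTM smult e_def)
  qed
  have e_ind: "e i i = ind i" for i
  proof -
    have "M i i = mat_diag N (\<lambda>p. of_bool (p = i))"
      by (intro eq_matI) (auto simp: M_def)
    then show ?thesis by (simp add: e_def diag_def)
  qed
  have sum_e: "(\<Sum>i<N. e i i) = 1"
    using diag_eq_sum_ind[of "\<lambda>_. 1"] by (simp add: e_ind diag_one)
  have normE: "norm (e 0 0) = 1"
    using assms by (simp add: e_ind norm_ind)
  define S where "S = {x. \<forall>i<N. \<forall>j<N. e 0 i * x * e j 0 \<in> range (\<lambda>c. scaleC c (e 0 0))}"
  have "bounded_linear (\<lambda>c. scaleC c (e 0 0))"
    by (rule bounded_linear_intro[where K = 1])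
      (auto simp: scaleC_add_left norm_scaleC normE scaleR_conv_of_real[where 'a = complex]
        simp flip: scaleC_of_real scaleC_scaleC)
  then have "complete (range (\<lambda>c. scaleC c (e 0 0)))"
    by (intro complete_isometric_image[of 1]) (auto simp: norm_scaleC normE complete_UNIV)
  then have clE: "closed (range (\<lambda>c. scaleC c (e 0 0)))"
    by (rule complete_imp_closed)
  have "S = (\<Inter>i\<in>{..<N}. \<Inter>j\<in>{..<N}. (\<lambda>x. e 0 i * x * e j 0) -` range (\<lambda>c. scaleC c (e 0 0)))"
    by (auto simp: S_def)
  moreover have "closed \<dots>"
    by (intro closed_INT ballI closed_vimage clE continuous_intros)
  ultimately have "closed S" by simp
  moreover have "S = \<phi> ` carrier_mat N N"
  proof (intro equalityI subsetI)
    fix x assume "x \<in> \<phi> ` carrier_mat N N"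
    then show "x \<in> S" by (auto simp: S_def eTe)
  next
    fix x assume "x \<in> S"
    then have "\<forall>i j. \<exists>c. i < N \<longrightarrow> j < N \<longrightarrow> e 0 i * x * e j 0 = scaleC c (e 0 0)"
      by (auto simp: S_def image_iff)
    then obtain t where t: "\<And>i j. i < N \<Longrightarrow> j < N \<Longrightarrow> e 0 i * x * e j 0 = scaleC (t i j) (e 0 0)"
      by metis
    \<comment> \<open>The scalars of the corners are the entries of the candidate preimage. It
      remains to show that \<open>y\<close>, all of whose corners vanish, is zero.\<close>
    define T where "T = mat N N (\<lambda>(i, j). t i j)"
    have T: "T \<in> carrier_mat N N" by (simp add: T_def)
    define y where "y = x - \<phi> T"
    have y0: "e 0 i * y * e j 0 = 0" if "i < N" "j < N" for i j
      using that t[OF that] eTe[OF T that, of 0 0]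
      by (simp add: y_def algebra_simps) (simp add: T_def)
    \<comment> \<open>Matrix units move the vanishing corner back to position \<open>(i, j)\<close>.
      As the \<open>e i i\<close> add up to 1, \<open>y\<close> is the sum of these blocks.\<close>
    have "e i i * y * e j j = 0" if ij: "i < N" "j < N" for i j
    proof -
      have "e i i * y * e j j = (e i 0 * e 0 i) * y * (e j 0 * e 0 j)"
        using ij assms by (simp add: ee)
      also have "\<dots> = e i 0 * (e 0 i * y * e j 0) * e 0 j"
        by (simp add: mult.assoc)
      finally show ?thesis using y0[OF ij] by simp
    qed
    then have "(\<Sum>i<N. \<Sum>j<N. e i i * y * e j j) = 0" by simp
    also have "(\<Sum>i<N. \<Sum>j<N. e i i * y * e j j) = (\<Sum>i<N. e i i) * y * (\<Sum>j<N. e j j)"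
      by (simp only: sum_distrib_right[where r = y] sum_product)
    finally have "x = \<phi> T" by (simp add: sum_e y_def)
    with T show "x \<in> \<phi> ` carrier_mat N N" by blast
  qed
  ultimately show ?thesis by simp
qed

section \<open>Projections onto the spans of the columns of a unitary that share a colour\<close>

context
  fixes U :: "complex mat" and K :: "'k set" and c :: "nat \<Rightarrow> 'k" and Q :: "'k \<Rightarrow> complex mat"
  assumes U: "U \<in> carrier_mat N N" "U * mat_adjoint U = 1\<^sub>m N"
  defines "Q \<equiv> \<lambda>k. U * mat_diag N (\<lambda>p. of_bool (c p = k)) * mat_adjoint U"
begin

lemma coloured_carrier: "Q k \<in> carrier_mat N N"
  unfolding Q_def
  by (intro mult_carrier_mat[of _ N N] mat_adjoint_carrier U(1) mat_diag_dim)

lemma coloured_image: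
  "\<phi> (Q k) = \<phi> U * diag (\<lambda>p. of_bool (c p = k)) * star (\<phi> U)"
proof -
  have "U * mat_diag N (\<lambda>p. of_bool (c p = k)) \<in> carrier_mat N N"
    using U(1) mat_diag_dim by (rule mult_carrier_mat)
  then show ?thesis
    using U(1) mat_adjoint_carrier[OF U(1)] by (simp add: Q_def diag_def mult adjoint)
qed

lemma unitary_image: "\<phi> U * star (\<phi> U) = 1" "star (\<phi> U) * \<phi> U = 1"
proof -
  have U': "mat_adjoint U \<in> carrier_mat N N"
    using U(1) by (rule mat_adjoint_carrier)
  have "mat_adjoint U * U = 1\<^sub>m N"
    using U(1) U' U(2) by (rule mat_mult_left_right_inverse)
  then show "\<phi> U * star (\<phi> U) = 1" "star (\<phi> U) * \<phi> U = 1"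
    using mult[OF U(1) U'] mult[OF U' U(1)] adjoint[OF U(1)] one U(2) by simp_all
qed

text \<open>The inner factor \<open>star (\<phi> U) * \<phi> U\<close> cancels, leaving the
  indicator of an intersection of colour classes. Idempotence and orthogonality are both read off
  from this.\<close>

lemma coloured_mult:
  "\<phi> (Q k) * \<phi> (Q l) = \<phi> U * diag (\<lambda>p. of_bool (c p = k \<and> c p = l)) * star (\<phi> U)"
proof -
  have "\<phi> (Q k) * \<phi> (Q l) = \<phi> U * diag (\<lambda>p. of_bool (c p = k)) * (star (\<phi> U) * \<phi> U)
      * diag (\<lambda>p. of_bool (c p = l)) * star (\<phi> U)"
    by (simp add: coloured_image mult.assoc)
  also have "\<dots> = \<phi> U * (diag (\<lambda>p. of_bool (c p = k)) * diag (\<lambda>p. of_bool (c p = l)))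
      * star (\<phi> U)"
    by (simp add: unitary_image mult.assoc)
  finally show ?thesis by (simp add: diag_mult of_bool_conj)
qed

lemma projection_coloured: "projection (\<phi> (Q k))"
proof -
  have "star (diag (\<lambda>p. of_bool (c p = k))) = diag (\<lambda>p. of_bool (c p = k))"
    using projection_diag_of_bool[of "\<lambda>p. c p = k"] by (simp add: projection_def)
  then have "star (\<phi> (Q k)) = \<phi> (Q k)"
    by (simp add: coloured_image star_mult star_star mult.assoc)
  moreover have "\<phi> (Q k) * \<phi> (Q k) = \<phi> (Q k)"
    unfolding coloured_mult by (simp add: coloured_image)
  ultimately show ?thesis by (simp add: projection_def)
qed

lemma coloured_orthogonal: "k \<noteq> l \<Longrightarrow> \<phi> (Q k) * \<phi> (Q l) = 0"
proof -
  assume "k \<noteq> l"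
  then have "diag (\<lambda>p. of_bool (c p = k \<and> c p = l)) = 0"
    by (auto simp: diag_eq_0_iff)
  then show ?thesis by (simp add: coloured_mult)
qed

text \<open>Every position has exactly one colour, so the indicators add up to 1, and conjugation by
  a unitary fixes 1.\<close>

lemma sum_coloured:
  assumes "finite K" "\<And>p. p < N \<Longrightarrow> c p \<in> K"
  shows "(\<Sum>k\<in>K. \<phi> (Q k)) = 1"
proof -
  have "(\<Sum>k\<in>K. diag (\<lambda>p. of_bool (c p = k))) = diag (\<lambda>p. \<Sum>k\<in>K. of_bool (c p = k))"
    by (simp add: diag_sum)
  also have "\<dots> = 1"
    unfolding diag_one[symmetric] using assms by (intro diag_cong) (simp add: of_bool_def)
  finally have "\<phi> U * (\<Sum>k\<in>K. diag (\<lambda>p. of_bool (c p = k))) * star (\<phi> U) = 1"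
    by (simp add: unitary_image)
  then show ?thesis
    by (simp add: coloured_image sum_distrib_left sum_distrib_right)
qed

text \<open>Conjugating back recovers the indicator of the colour class, and this class contains
  \<open>p\<close>.\<close>

lemma coloured_nonzero:
  assumes "p < N" "c p = k"
  shows "\<phi> (Q k) \<noteq> 0"
proof
  assume "\<phi> (Q k) = 0"
  then have "star (\<phi> U) * \<phi> (Q k) * \<phi> U = 0" by simp
  moreover have "star (\<phi> U) * \<phi> (Q k) * \<phi> U =
      (star (\<phi> U) * \<phi> U) * diag (\<lambda>p. of_bool (c p = k)) * (star (\<phi> U) * \<phi> U)"
    by (simp add: coloured_image mult.assoc)
  ultimately have "diag (\<lambda>p. of_bool (c p = k)) = 0" by (simp add: unitary_image)
  with assms show False by (auto simp: diag_eq_0_iff)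
qed

text \<open>The weights are the squared moduli of row \<open>p\<close> of \<open>U\<close>. Where
  these are constant, the diagonal entry reduces to counting the positions of colour
  \<open>k\<close>.\<close>

lemma coloured_diagonal_entry:
  assumes "p < N"
  shows "Q k $$ (p, p) = (\<Sum>q<N. of_bool (c q = k) * of_real ((cmod (U $$ (p, q)))\<^sup>2))"
proof -
  have "Q k $$ (p, p) =
      (\<Sum>q<N. U $$ (p, q) * of_bool (c q = k) * cnj (U $$ (p, q)))"
    using U assms
    by (simp add: Q_def mat_diag_mult_right[of _ N] scalar_prod_def mat_adjoint_index
        lessThan_atLeast0)
  also have "\<dots> = (\<Sum>q<N. of_bool (c q = k) * of_real ((cmod (U $$ (p, q)))\<^sup>2))"
    by (intro sum.cong) (auto simp: complex_norm_square simp del: of_real_power)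
  finally show ?thesis .
qed

end

end


section \<open>Fourier matrices on residue classes\<close>

text \<open>The members of the class are the numbers \<open>i + N * s\<close> with
  \<open>s < d\<close>, and division by \<open>N\<close> recovers \<open>s\<close>.\<close>

lemma sum_residue_class:
  fixes f :: "nat \<Rightarrow> 'b::comm_monoid_add"
  assumes "i < N"
  shows "(\<Sum>q<d * N. if q mod N = i then f (q div N) else 0) = (\<Sum>s<d. f s)"
proof -
  have "(\<Sum>q<d * N. if q mod N = i then f (q div N) else 0) =
      (\<Sum>q\<in>{q. q < d * N \<and> q mod N = i}. f (q div N))"
    by (intro sum.mono_neutral_cong_right) auto
  also have "\<dots> = (\<Sum>s<d. f s)"
  proof (rule sum.reindex_bij_witness[where i = "\<lambda>s. i + N * s" and j = "\<lambda>q. q div N"])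
    fix s assume "s \<in> {..<d}"
    then have "i + N * s < N * Suc s" "N * Suc s \<le> N * d"
      using assms by (auto simp del: mult_Suc_right intro!: mult_le_mono2) simp
    then show "i + N * s \<in> {q. q < d * N \<and> q mod N = i}"
      using assms by (simp add: mult.commute)
  qed (use assms in \<open>auto simp: less_mult_imp_div_less\<close>)
  finally show ?thesis .
qed

text \<open>The summands are the powers of a \<open>d\<close>-th root of unity \<open>z\<close>.
  Since \<open>a\<close> and \<open>b\<close> are below \<open>d\<close>, \<open>z\<close> is 1 only
  if they agree; otherwise the geometric sum vanishes.\<close>

lemma fourier_orthogonality:
  fixes a b d :: nat
  assumes "a < d" "b < d"
  shows "(\<Sum>s<d. cis (2 * pi * a * s / d) * cnj (cis (2 * pi * b * s / d))) =
    (if a = b then of_nat d else 0)"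
proof -
  define z where "z = cis (2 * pi * a / d) * cnj (cis (2 * pi * b / d))"
  have pow: "cis (2 * pi * a * s / d) * cnj (cis (2 * pi * b * s / d)) = z ^ s" for s :: nat
    by (simp add: z_def power_mult_distrib Complex.DeMoivre cis_cnj mult_ac)
  have "z = 1 \<longleftrightarrow> a = b"
  proof
    assume "z = 1"
    then have "cis (2 * pi * a / d) = cis (2 * pi * b / d)"
      by (simp add: z_def cis_cnj flip: cis_inverse) (simp add: field_simps)
    then show "a = b"
      using Complex.bij_betw_roots_unity[of d] assms
      by (auto simp: bij_betw_def dest!: inj_onD)
  qed (simp add: z_def cis_cnj cis_mult)
  moreover have "z ^ d = 1"
    using pow[of d] assms by simp
  ultimately show ?thesis
    unfolding pow using geometric_sum[of z d] by (cases "a = b") simp_all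
qed

text \<open>Within each residue class modulo \<open>N\<close>, that is, within the copies of one diagonal position
  of \<open>M\<^sub>N\<close> in its \<open>d\<close>-fold amplification, this is the unitary Fourier matrix of size \<open>d\<close>.\<close>

definition fourier_blocks :: "nat \<Rightarrow> nat \<Rightarrow> complex mat" where
  "fourier_blocks N d = mat (d * N) (d * N) (\<lambda>(p, q).
     if p mod N = q mod N then cis (2 * pi * (p div N) * (q div N) / d) / sqrt d else 0)"

lemma fourier_blocks_carrier: "fourier_blocks N d \<in> carrier_mat (d * N) (d * N)"
  by (simp add: fourier_blocks_def)

text \<open>Rows from different residue classes have disjoint supports. Within one class the claim
  is Fourier orthogonality, because \<open>p\<close> is determined by \<open>p mod N\<close> and
  \<open>p div N\<close>.\<close>

lemma fourier_blocks_unitary: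
  "fourier_blocks N d * mat_adjoint (fourier_blocks N d) = 1\<^sub>m (d * N)"
proof (intro eq_matI)
  fix p p' assume "p < dim_row (1\<^sub>m (d * N) :: complex mat)" "p' < dim_col (1\<^sub>m (d * N) :: complex mat)"
  then have p: "p < d * N" "p' < d * N" by auto
  then have pos: "0 < N" "0 < d" by (auto intro: Nat.gr0I)
  have "(fourier_blocks N d * mat_adjoint (fourier_blocks N d)) $$ (p, p') =
      (\<Sum>q<d * N. fourier_blocks N d $$ (p, q) * cnj (fourier_blocks N d $$ (p', q)))"
    using p fourier_blocks_carrier[of N d]
    by (simp add: scalar_prod_def mat_adjoint_index lessThan_atLeast0)
  also have "\<dots> = (\<Sum>q<d * N. if q mod N = p mod N then
      (if p mod N = p' mod N then
        cis (2 * pi * (p div N) * (q div N) / d) * cnj (cis (2 * pi * (p' div N) * (q div N) / d)) / d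
       else 0) else 0)"
    using p by (intro sum.cong)
      (auto simp: fourier_blocks_def simp flip: of_real_mult)
  also have "\<dots> = (\<Sum>s<d. if p mod N = p' mod N then
        cis (2 * pi * (p div N) * s / d) * cnj (cis (2 * pi * (p' div N) * s / d)) / d else 0)"
    using pos by (intro sum_residue_class) auto
  also have "\<dots> = (if p mod N = p' mod N \<and> p div N = p' div N then 1 else 0)"
    using p pos by (cases "p mod N = p' mod N")
      (simp_all add: fourier_orthogonality less_mult_imp_div_less flip: sum_divide_distrib)
  also have "\<dots> = 1\<^sub>m (d * N) $$ (p, p')"
    using p by (metis div_mult_mod_eq index_one_mat(1))
  finally show "(fourier_blocks N d * mat_adjoint (fourier_blocks N d)) $$ (p, p') =
      1\<^sub>m (d * N) $$ (p, p')" .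
qed (use fourier_blocks_carrier[of N d] in auto)

text \<open>Constant moduli within a residue class turn the diagonal entries of the coloured
  projections into relative frequencies of colours.\<close>

lemma fourier_blocks_cmod:
  "p < d * N \<Longrightarrow> q < d * N \<Longrightarrow>
    (cmod (fourier_blocks N d $$ (p, q)))\<^sup>2 = (if q mod N = p mod N then 1 / d else 0)"
  by (auto simp: fourier_blocks_def norm_divide power_divide)


section \<open>Colourings with prescribed frequencies\<close>

text \<open>The disjoint union of blocks of sizes \<open>r k\<close> has \<open>d\<close> elements.
  Its block labels, pulled back along a bijection, give the colouring.\<close>

lemma colouring_with_class_sizes:
  assumes "finite K" "sum r K = d"
  obtains c where "\<And>s. s < d \<Longrightarrow> c s \<in> K" "\<And>k. k \<in> K \<Longrightarrow> card {s. s < d \<and> c s = k} = r k"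
proof -
  have "card (SIGMA k:K. {..<r k}) = card {..<d}"
    using assms by simp
  then obtain h where h: "bij_betw h {..<d} (SIGMA k:K. {..<r k})"
    using assms finite_same_card_bij[of "{..<d}" "SIGMA k:K. {..<r k}"] by auto
  show thesis
  proof
    show "(fst \<circ> h) s \<in> K" if "s < d" for s
      using bij_betwE[OF h] that by (auto dest!: bspec[of _ _ s])
    fix k assume "k \<in> K"
    have "h ` {s. s < d \<and> (fst \<circ> h) s = k} = {x \<in> h ` {..<d}. fst x = k}" by auto
    also have "\<dots> = {k} \<times> {..<r k}"
      using bij_betw_imp_surj_on[OF h] \<open>k \<in> K\<close> by auto
    finally have "card (h ` {s. s < d \<and> (fst \<circ> h) s = k}) = r k" by simp
    moreover have "inj_on h {s. s < d \<and> (fst \<circ> h) s = k}"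
      using bij_betw_imp_inj_on[OF h] by (rule inj_on_subset) auto
    ultimately show "card {s. s < d \<and> (fst \<circ> h) s = k} = r k"
      by (simp add: card_image)
  qed
qed

text \<open>Class sizes come from rounding \<open>d * a k\<close> while keeping every class
  nonempty. The error bound does not depend on \<open>d\<close>, so it becomes negligible after
  division by a large \<open>d\<close>.\<close>

lemma colouring_with_frequencies:
  fixes a :: "'k \<Rightarrow> real"
  assumes K: "finite K" "card K \<le> d"
    and a: "\<And>k. k \<in> K \<Longrightarrow> 0 \<le> a k" "sum a K = 1"
  obtains c where "\<And>s. s < d \<Longrightarrow> c s \<in> K"
    "\<And>k. k \<in> K \<Longrightarrow> 0 < card {s. s < d \<and> c s = k}"
    "\<And>k. k \<in> K \<Longrightarrow> \<bar>card {s. s < d \<and> c s = k} - d * a k\<bar> \<le> (real (card K))\<^sup>2"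
proof -
  define m where "m = card K"
  obtain k0 where k0: "k0 \<in> K" using a by fastforce
  have m: "m \<ge> 1" using K k0 by (metis One_nat_def Suc_leI card_gt_0_iff empty_iff m_def)
  \<comment> \<open>One place is reserved for each of the \<open>m\<close> colours, and the other
    \<open>d - m\<close> places are shared in proportion to \<open>a\<close>, rounded down. The
    total therefore does not exceed \<open>d\<close>.\<close>
  define q where "q k = nat \<lfloor>a k * real (d - m)\<rfloor> + 1" for k
  have q: "a k * real (d - m) \<le> q k" "q k \<le> a k * real (d - m) + 1" if "k \<in> K" for k
    using a(1)[OF that] unfolding q_def by (simp_all add: of_nat_nat) linarith+
  have "real (sum q K) \<le> (\<Sum>k\<in>K. a k * real (d - m) + 1)"
    unfolding of_nat_sum by (intro sum_mono q)
  also have "\<dots> = real (d - m) + m"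
    by (simp add: sum.distrib a m_def flip: sum_distrib_right)
  also have "\<dots> = d" using K by (simp add: m_def of_nat_diff)
  finally have le: "sum q K \<le> d" by (simp only: of_nat_le_iff)
  \<comment> \<open>The places lost to rounding all go to the single colour
    \<open>k0\<close>.\<close>
  define r where "r k = q k + (if k = k0 then d - sum q K else 0)" for k
  have sum_r: "sum r K = d"
    using k0 K le by (simp add: r_def sum.distrib)
  have a1: "a k \<le> 1" if "k \<in> K" for k
    using member_le_sum[of k K a] that K a by auto
  have lower: "d * a k - m \<le> r k" if k: "k \<in> K" for k
  proof -
    have "a k * m \<le> 1 * real m" using a1[OF k] by (intro mult_right_mono) auto
    then have "d * a k - m \<le> a k * real (d - m)"
      using K by (simp add: m_def of_nat_diff algebra_simps)
    also have "\<dots> \<le> r k" using q(1)[OF k] by (simp add: r_def)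
    finally show ?thesis .
  qed
  \<comment> \<open>The sizes add up to \<open>d\<close>, so an excess of one class is a deficit of
    the others. Each of these \<open>m - 1\<close> deficits is at most \<open>m\<close> by
    \<open>lower\<close>, which also covers \<open>k0\<close>.\<close>
  have bound: "\<bar>r k - d * a k\<bar> \<le> (real m)\<^sup>2" if k: "k \<in> K" for k
  proof -
    have "(\<Sum>j\<in>K - {k}. d * a j - m) \<le> (\<Sum>j\<in>K - {k}. real (r j))"
      by (intro sum_mono lower) auto
    moreover have "(\<Sum>j\<in>K - {k}. real (r j)) = real d - r k"
      using K k sum.remove[of K k "\<lambda>j. real (r j)"] sum_r by (simp flip: of_nat_sum)
    moreover have "(\<Sum>j\<in>K - {k}. d * a j - m) = d * (1 - a k) - (real m - 1) * m"
      using K k sum.remove[of K k a] a m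
      by (simp add: sum_subtractf m_def of_nat_diff flip: sum_distrib_left)
    ultimately have "r k - d * a k \<le> (real m - 1) * m"
      by (simp add: algebra_simps)
    also have "\<dots> \<le> (real m)\<^sup>2" by (simp add: power2_eq_square mult_right_mono)
    finally have "r k - d * a k \<le> (real m)\<^sup>2" .
    moreover have "real m \<le> (real m)\<^sup>2" using m by (simp add: power2_eq_square)
    ultimately show ?thesis using lower[OF k] by linarith
  qed
  obtain c where c: "\<And>s. s < d \<Longrightarrow> c s \<in> K" "\<And>k. k \<in> K \<Longrightarrow> card {s. s < d \<and> c s = k} = r k"
    using colouring_with_class_sizes[OF K(1) sum_r] by blast
  show thesis
  proof (rule that[OF c(1)])
    show "0 < card {s. s < d \<and> c s = k}" if "k \<in> K" for k
      using c(2)[OF that] by (simp add: r_def q_def)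
    show "\<bar>card {s. s < d \<and> c s = k} - d * a k\<bar> \<le> (real (card K))\<^sup>2" if "k \<in> K" for k
      using c(2)[OF that] bound[OF that] by (simp add: m_def)
  qed
qed


section \<open>UHF algebras\<close>

locale uhf =
  fixes n :: "nat \<Rightarrow> nat" and \<phi> :: "nat \<Rightarrow> complex mat \<Rightarrow> 'a::unital_cstar_algebra"
  assumes system: "uhf_system n \<phi>"
begin

sublocale level: matrix_representation "n j" "\<phi> j" for j
  using system by unfold_locales (simp add: uhf_system_def)

section \<open>Growth of the matrix levels\<close>

lemma n_pos: "0 < n j"
  using system by (simp add: uhf_system_def)

lemma n_dvd: "j \<le> l \<Longrightarrow> n j dvd n l"
proof (induction l rule: dec_induct)
  case (step l)
  moreover have "n l dvd n (Suc l)" using system by (simp add: uhf_system_def)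
  ultimately show ?case by (rule_tac dvd_trans)
qed simp

lemma n_mono: "j \<le> l \<Longrightarrow> n j \<le> n l"
  using n_dvd n_pos by (simp add: dvd_imp_le)

lemma phi_Suc:
  "T \<in> carrier_mat (n j) (n j) \<Longrightarrow>
    \<phi> j T = \<phi> (Suc j) (amplification (n (Suc j) div n j) T)"
  using system by (simp add: uhf_system_def)

lemma range_mono:
  "j \<le> l \<Longrightarrow> \<phi> j ` carrier_mat (n j) (n j) \<subseteq> \<phi> l ` carrier_mat (n l) (n l)"
proof (induction l rule: dec_induct)
  case (step l)
  have "n (Suc l) div n l * n l = n (Suc l)" using n_dvd[of l "Suc l"] by simp
  then have "amplification (n (Suc l) div n l) T \<in> carrier_mat (n (Suc l)) (n (Suc l))"
    if "T \<in> carrier_mat (n l) (n l)" for T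
    using amplification_carrier[OF that, of "n (Suc l) div n l"] by simp
  then have "\<phi> l ` carrier_mat (n l) (n l) \<subseteq> \<phi> (Suc l) ` carrier_mat (n (Suc l)) (n (Suc l))"
    by (auto simp: phi_Suc)
  with step.IH show ?case by blast
qed simp

text \<open>This is where the algebra being infinite enters. Bounded sizes would stabilise at some
  \<open>J\<close>, after which the ranges no longer change. Their union would be the range of
  \<open>\<phi> J\<close>, which is closed and dense, hence everything.\<close>

lemma n_unbounded:
  assumes "\<not> is_matrix_algebra TYPE('a)"
  shows "\<exists>l. B < n l"
proof (rule ccontr)
  assume "\<not> ?thesis"
  then have fin: "finite (range n)"
    by (intro finite_subset[of "range n" "{..B}"]) (auto simp: not_less)
  then obtain J where "Max (range n) = n J"
    using Max_in[OF fin] by blast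
  then have J: "n l \<le> n J" for l
    using Max_ge[OF fin, of "n l"] by simp
  have const: "n l = n J" if "J \<le> l" for l
    using n_mono[OF that] J[of l] by simp
  have same: "\<phi> l ` carrier_mat (n l) (n l) = \<phi> J ` carrier_mat (n J) (n J)" if "J \<le> l" for l
    using that
  proof (induction l rule: dec_induct)
    case (step l)
    \<comment> \<open>Between levels of equal size the amplification consists of a single copy, so
      the connecting map is the identity.\<close>
    have "\<phi> (Suc l) T = \<phi> l T" if "T \<in> carrier_mat (n l) (n l)" for T
      using phi_Suc[OF that] const[of l] const[of "Suc l"] step.hyps n_pos[of J]
      by (simp add: amplification_def del: diag_block_mat.simps)
    then have "\<phi> (Suc l) ` carrier_mat (n l) (n l) = \<phi> l ` carrier_mat (n l) (n l)"
      by (rule image_cong[OF refl])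
    with step show ?case using const[of l] const[of "Suc l"] by simp
  qed simp
  have "\<phi> l ` carrier_mat (n l) (n l) \<subseteq> \<phi> J ` carrier_mat (n J) (n J)" for l
    using range_mono[of l J] same[of l] by (cases "J \<le> l") auto
  then have "(\<Union>l. \<phi> l ` carrier_mat (n l) (n l)) = \<phi> J ` carrier_mat (n J) (n J)"
    by blast
  moreover have "closure (\<Union>l. \<phi> l ` carrier_mat (n l) (n l)) = UNIV"
    using system by (simp add: uhf_system_def)
  ultimately have "\<phi> J ` carrier_mat (n J) (n J) = UNIV"
    using level.closed_range[OF n_pos] by (simp add: closure_closed)
  with assms level.embedding n_pos show False
    unfolding is_matrix_algebra_def by blast
qed

text \<open>Each amplification repeats the diagonal periodically. The successive reductions compose
  to \<open>p mod n j\<close> because the sizes divide one another.\<close>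

lemma diag_lift: "j \<le> l \<Longrightarrow> level.diag j f = level.diag l (\<lambda>p. f (p mod n j))"
proof (induction l rule: dec_induct)
  case base
  show ?case by (rule level.diag_cong) simp
next
  case (step l)
  have "level.diag l (\<lambda>p. f (p mod n j)) = level.diag (Suc l) (\<lambda>p. f (p mod n l mod n j))"
    using n_dvd[of l "Suc l"]
    by (simp add: level.diag_def phi_Suc amplification_mat_diag n_pos)
  with step show ?case by (simp add: mod_mod_cancel n_dvd)
qed

lemma diagonal_image:
  "\<phi> j ` {T \<in> carrier_mat (n j) (n j). diagonal_mat T} = range (level.diag j)"
proof -
  have "{T \<in> carrier_mat (n j) (n j). diagonal_mat T} =
      range (mat_diag (n j) :: _ \<Rightarrow> complex mat)"
    using mat_diag_eqI mat_diag_diagonal mat_diag_dim by blast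
  then show ?thesis by (simp add: level.diag_def[abs_def] image_image)
qed

text \<open>An approximant from one level reappears at all higher levels. Stating this as an
  eventual property lets finitely many elements share one level.\<close>

lemma eventually_near_diag:
  assumes "x \<in> uhf_diagonal n \<phi>" "0 < \<delta>"
  shows "eventually (\<lambda>l. \<exists>f. norm (level.diag l f - x) < \<delta>) sequentially"
proof -
  obtain j f where "norm (level.diag j f - x) < \<delta>"
    using assms unfolding uhf_diagonal_def diagonal_image closure_approachable
    by (auto simp: dist_norm)
  then show ?thesis
    unfolding eventually_sequentially by (metis diag_lift)
qed

text \<open>The index \<open>i\<close>, read in every level at once, singles out a point of the Cantor spectrum of the
  diagonal, and \<open>diag_value i x c\<close> says that the corresponding character maps \<open>x\<close> to \<open>c\<close>.\<close>

definition diag_value :: "nat \<Rightarrow> 'a \<Rightarrow> complex \<Rightarrow> bool" where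
  "diag_value i x c \<longleftrightarrow> (\<lambda>l. norm ((x - scaleC c 1) * level.ind l i)) \<longlonglongrightarrow> 0"

section \<open>Properties of the characters attached to indices\<close>

lemma diag_value_bound:
  assumes "\<And>\<epsilon>. 0 < \<epsilon> \<Longrightarrow> eventually (\<lambda>l. norm ((x - scaleC c 1) * level.ind l i) \<le> \<epsilon>) sequentially"
  shows "diag_value i x c"
  unfolding diag_value_def
proof (rule tendstoI)
  fix \<epsilon> :: real assume "0 < \<epsilon>"
  then show "\<forall>\<^sub>F l in sequentially. dist (norm ((x - scaleC c 1) * level.ind l i)) 0 < \<epsilon>"
    using assms[of "\<epsilon> / 2"] by (auto elim: eventually_mono)
qed

lemma diag_value_add:
  assumes "diag_value i x c" "diag_value i y d"
  shows "diag_value i (x + y) (c + d)"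
  unfolding diag_value_def
proof (rule Lim_null_comparison)
  show "(\<lambda>l. norm ((x - scaleC c 1) * level.ind l i) + norm ((y - scaleC d 1) * level.ind l i)) \<longlonglongrightarrow> 0"
    using tendsto_add[OF assms[unfolded diag_value_def]] by simp
  have "(x + y - scaleC (c + d) 1) * z = (x - scaleC c 1) * z + (y - scaleC d 1) * z" for z
    by (simp add: scaleC_add_left algebra_simps)
  then show "\<forall>\<^sub>F l in sequentially. norm (norm ((x + y - scaleC (c + d) 1) * level.ind l i))
      \<le> norm ((x - scaleC c 1) * level.ind l i) + norm ((y - scaleC d 1) * level.ind l i)"
    by (simp add: norm_triangle_ineq)
qed

lemma diag_value_minus:
  assumes "diag_value i x c"
  shows "diag_value i (- x) (- c)"
proof -
  have "(- x - scaleC (- c) 1) * z = - ((x - scaleC c 1) * z)" for z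
    by (simp add: scaleC_minus_left algebra_simps)
  then show ?thesis
    using assms by (simp add: diag_value_def)
qed

lemma diag_value_diff:
  "diag_value i x c \<Longrightarrow> diag_value i y d \<Longrightarrow> diag_value i (x - y) (c - d)"
  using diag_value_add[of i x c "- y" "- d"] by (simp add: diag_value_minus)

lemma diag_value_scalar: "diag_value i (scaleC c 1) c"
  by (simp add: diag_value_def)

lemma diag_value_sum:
  "(\<And>k. k \<in> K \<Longrightarrow> diag_value i (x k) (c k)) \<Longrightarrow> diag_value i (sum x K) (sum c K)"
proof (induction K rule: infinite_finite_induct)
  case (insert k K)
  then show ?case by (simp add: diag_value_add)
qed (use diag_value_scalar[of i 0] in auto)

lemma eventually_norm_ind:
  assumes "i < n j"
  shows "eventually (\<lambda>l. norm (level.ind l i) = 1) sequentially"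
  using eventually_ge_at_top[of j]
proof eventually_elim
  case (elim l)
  then show ?case using assms n_mono[of j l] by (simp add: level.norm_ind)
qed

text \<open>Characters are contractive: \<open>scaleC c 1\<close> and \<open>x\<close> act almost
  alike on \<open>level.ind l i\<close>, which has norm 1 once the index \<open>i\<close> exists at
  level \<open>l\<close>.\<close>

lemma diag_value_norm_le:
  assumes "i < n j" "diag_value i x c"
  shows "cmod c \<le> norm x"
proof (rule tendsto_lowerbound)
  show "(\<lambda>l. norm x + norm ((x - scaleC c 1) * level.ind l i)) \<longlonglongrightarrow> norm x"
    using tendsto_add[OF tendsto_const assms(2)[unfolded diag_value_def]] by simp
  show "\<forall>\<^sub>F l in sequentially. cmod c \<le> norm x + norm ((x - scaleC c 1) * level.ind l i)"
    using eventually_norm_ind[OF assms(1)]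
  proof eventually_elim
    case (elim l)
    have "cmod c = norm (scaleC c 1 * level.ind l i)"
      using elim by (simp add: scaleC_mult_left norm_scaleC)
    also have "scaleC c 1 * level.ind l i = x * level.ind l i - (x - scaleC c 1) * level.ind l i"
      by (simp add: algebra_simps)
    also have "norm \<dots> \<le> norm (x * level.ind l i) + norm ((x - scaleC c 1) * level.ind l i)"
      by (rule norm_triangle_ineq4)
    also have "norm (x * level.ind l i) \<le> norm x"
      using norm_mult_ineq[of x "level.ind l i"] elim by simp
    finally show ?case by simp
  qed
qed simp

lemma diag_value_unique:
  assumes "i < n j" "diag_value i x c" "diag_value i x d"
  shows "c = d"
  using diag_value_norm_le[OF assms(1) diag_value_diff[OF assms(2,3)]] by simp

text \<open>The elements \<open>level.ind l i\<close> act as approximate eigenvectors: they have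
  norm 1 eventually, while \<open>x - scaleC c 1\<close> sends them to 0 in the limit. A left
  inverse \<open>y\<close> would contradict this.\<close>

lemma diag_value_spectrum:
  assumes "i < n j" "diag_value i x c"
  shows "c \<in> cstar_spectrum x"
proof (rule ccontr)
  assume "\<not> ?thesis"
  then obtain y where y: "y * (scaleC c 1 - x) = 1"
    by (auto simp: cstar_spectrum_def invertible_element_def)
  have "(\<lambda>l. norm y * norm ((x - scaleC c 1) * level.ind l i)) \<longlonglongrightarrow> 0"
    using tendsto_mult[OF tendsto_const assms(2)[unfolded diag_value_def], of "norm y"] by simp
  moreover have "\<forall>\<^sub>F l in sequentially. 1 \<le> norm y * norm ((x - scaleC c 1) * level.ind l i)"
    using eventually_norm_ind[OF assms(1)]
  proof eventually_elim
    case (elim l)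
    have "level.ind l i = y * (scaleC c 1 - x) * level.ind l i" by (simp add: y)
    also have "\<dots> = - (y * ((x - scaleC c 1) * level.ind l i))" by (simp add: algebra_simps)
    finally have "norm (level.ind l i) = norm (y * ((x - scaleC c 1) * level.ind l i))"
      by (metis norm_minus_cancel)
    then show ?case using elim norm_mult_ineq[of y] by metis
  qed
  ultimately have "(1::real) \<le> 0"
    by (intro tendsto_lowerbound) auto
  then show False by simp
qed

lemma diag_value_diag:
  assumes "i < n j"
  shows "diag_value i (level.diag j f) (f i)"
proof (rule diag_value_bound)
  fix \<epsilon> :: real assume "0 < \<epsilon>"
  show "\<forall>\<^sub>F l in sequentially. norm ((level.diag j f - scaleC (f i) 1) * level.ind l i) \<le> \<epsilon>"
    using eventually_ge_at_top[of j]
  proof eventually_elim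
    case (elim l)
    have "(level.diag j f - scaleC (f i) 1) * level.ind l i =
        level.diag l (\<lambda>p. (f (p mod n j) - f i) * of_bool (p = i))"
      using elim by (simp add: diag_lift[of j l] level.diag_mult flip: level.diag_const[where j = l] level.diag_diff)
    \<comment> \<open>Only \<open>p = i\<close> could contribute, and there
      \<open>i mod n j = i\<close> since \<open>i < n j\<close>.\<close>
    also have "\<dots> = 0" using assms by (auto simp: level.diag_eq_0_iff)
    finally show ?case using \<open>0 < \<epsilon>\<close> by simp
  qed
qed

text \<open>Elements of the levels approximating \<open>x\<close> have values at \<open>i\<close>.
  By contractivity these values form a Cauchy sequence, and its limit is the value of
  \<open>x\<close>.\<close>

lemma diag_value_exists:
  assumes "i < n j" "x \<in> uhf_diagonal n \<phi>"
  obtains c where "diag_value i x c"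
proof -
  have "\<forall>k. \<exists>y c. diag_value i y c \<and> norm (y - x) < inverse (Suc k)"
  proof
    fix k
    have "\<forall>\<^sub>F l in sequentially. j \<le> l \<and> (\<exists>f. norm (level.diag l f - x) < inverse (Suc k))"
      using assms by (intro eventually_conj eventually_ge_at_top eventually_near_diag) auto
    then obtain l f where "j \<le> l" "norm (level.diag l f - x) < inverse (Suc k)"
      by (auto simp: eventually_sequentially)
    moreover have "i < n l" using assms(1) n_mono[OF \<open>j \<le> l\<close>] by simp
    ultimately show "\<exists>y c. diag_value i y c \<and> norm (y - x) < inverse (Suc k)"
      using diag_value_diag by blast
  qed
  then obtain y c where yc: "\<And>k. diag_value i (y k) (c k)" "\<And>k. norm (y k - x) < inverse (Suc k)"
    by metis
  have "(\<lambda>k. y k - x) \<longlonglongrightarrow> 0"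
    using LIMSEQ_inverse_real_of_nat
    by (rule Lim_null_comparison[rotated]) (intro always_eventually allI less_imp_le yc(2))
  then have lim: "y \<longlonglongrightarrow> x" by (rule LIM_zero_cancel)
  then have "Cauchy y" by (rule LIMSEQ_imp_Cauchy)
  moreover have "dist (c k) (c l) \<le> dist (y k) (y l)" for k l
    using diag_value_norm_le[OF assms(1) diag_value_diff[OF yc(1) yc(1)]] by (simp add: dist_norm)
  ultimately have "Cauchy c"
    unfolding Cauchy_def by (meson le_less_trans)
  then obtain d where d: "c \<longlonglongrightarrow> d"
    by (auto simp: Cauchy_convergent_iff convergent_def)
  have "diag_value i x d"
  proof (rule diag_value_bound)
    fix \<epsilon> :: real assume "0 < \<epsilon>"
    have "(\<lambda>k. norm (x - y k) + cmod (c k - d)) \<longlonglongrightarrow> norm (x - x) + cmod (d - d)"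
      by (intro tendsto_intros lim d)
    then have "\<forall>\<^sub>F k in sequentially. norm (x - y k) + cmod (c k - d) < \<epsilon> / 2"
      using \<open>0 < \<epsilon>\<close> by (intro order_tendstoD) auto
    then obtain k where k: "norm (x - y k) + cmod (c k - d) < \<epsilon> / 2"
      by (auto simp: eventually_sequentially)
    have "\<forall>\<^sub>F l in sequentially. norm ((y k - scaleC (c k) 1) * level.ind l i) < \<epsilon> / 2"
      using yc(1)[of k] \<open>0 < \<epsilon>\<close> unfolding diag_value_def by (intro order_tendstoD) auto
    then show "\<forall>\<^sub>F l in sequentially. norm ((x - scaleC d 1) * level.ind l i) \<le> \<epsilon>"
    proof eventually_elim
      case (elim l)
      let ?e = "level.ind l i"
      have "(x - scaleC d 1) * ?e =
          (x - y k) * ?e + scaleC (c k - d) ?e + (y k - scaleC (c k) 1) * ?e"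
        by (simp add: algebra_simps scaleC_diff_left scaleC_mult_left)
      also have "norm \<dots> \<le> norm ((x - y k) * ?e) + norm (scaleC (c k - d) ?e)
          + norm ((y k - scaleC (c k) 1) * ?e)"
        by (meson add_mono norm_triangle_ineq norm_triangle_mono order_refl)
      also have "norm ((x - y k) * ?e) \<le> norm (x - y k)"
        using norm_mult_ineq[of "x - y k" ?e] level.norm_ind_le[of l i]
        by (meson mult_left_le norm_ge_zero order_trans)
      also have "norm (scaleC (c k - d) ?e) \<le> cmod (c k - d)"
        using level.norm_ind_le[of l i] by (simp add: norm_scaleC mult_left_le)
      finally show ?case using elim k by simp
    qed
  qed
  then show thesis by (rule that)
qed

section \<open>Construction of the projections\<close>

lemma partition_approximated_by_projections:
  assumes "\<not> is_matrix_algebra TYPE('a)"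
    and E: "uhf_expectation n \<phi> E"
    and K: "finite K"
    and A: "\<And>k. k \<in> K \<Longrightarrow> A k \<in> uhf_diagonal n \<phi>" "\<And>k. k \<in> K \<Longrightarrow> cstar_positive (A k)"
    and sum_A: "sum A K = 1"
    and "\<epsilon> > 0"
  obtains P where "\<And>k. k \<in> K \<Longrightarrow> projection (P k) \<and> P k \<noteq> 0"
    "\<And>k l. k \<noteq> l \<Longrightarrow> P k * P l = 0"
    "sum P K = 1"
    "\<And>k. k \<in> K \<Longrightarrow> norm (E (P k) - A k) < \<epsilon>"
proof -
  \<comment> \<open>Three errors of size at most \<open>\<delta>\<close> occur: from
    \<open>A k\<close> to \<open>f k\<close>, from \<open>f k\<close> to \<open>a k\<close>, and
    from \<open>a k\<close> to the colour frequencies. The factor 4 makes the final inequality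
    strict.\<close>
  define \<delta> where "\<delta> = \<epsilon> / 4"
  have \<delta>: "\<delta> > 0" using \<open>\<epsilon> > 0\<close> by (simp add: \<delta>_def)
  have "\<forall>\<^sub>F j in sequentially. \<forall>k\<in>K. \<exists>f. norm (level.diag j f - A k) < \<delta>"
    using K A(1) \<delta> by (intro eventually_ball_finite ballI eventually_near_diag)
  then obtain j where "\<forall>k\<in>K. \<exists>f. norm (level.diag j f - A k) < \<delta>"
    by (auto simp: eventually_sequentially)
  then obtain f where f: "\<And>k. k \<in> K \<Longrightarrow> norm (level.diag j (f k) - A k) < \<delta>"
    by metis
  define N where "N = n j"
  have N: "0 < N" by (simp add: N_def n_pos)
  \<comment> \<open>The entries of \<open>f k\<close> may be complex and need not add up to 1 over
    \<open>k\<close>. The character values of \<open>A k\<close> itself are exactly nonnegative with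
    sum 1, so they replace those entries.\<close>
  have "\<exists>r\<ge>0. diag_value i (A k) (complex_of_real r)" if "k \<in> K" "i < N" for k i
  proof -
    obtain z where z: "diag_value i (A k) z"
      using diag_value_exists[of i j "A k"] A(1) \<open>k \<in> K\<close> \<open>i < N\<close> by (auto simp: N_def)
    then have "z \<in> cstar_spectrum (A k)"
      using that unfolding N_def by (intro diag_value_spectrum)
    then obtain r where "0 \<le> r" "z = complex_of_real r"
      using A(2)[OF \<open>k \<in> K\<close>] by (auto simp: cstar_positive_def)
    with z show ?thesis by blast
  qed
  then obtain a where a: "\<And>k i. k \<in> K \<Longrightarrow> i < N \<Longrightarrow> 0 \<le> a k i"
    "\<And>k i. k \<in> K \<Longrightarrow> i < N \<Longrightarrow> diag_value i (A k) (complex_of_real (a k i))"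
    by metis
  have sum_a: "(\<Sum>k\<in>K. a k i) = 1" if "i < N" for i
  proof -
    have "diag_value i (sum A K) (\<Sum>k\<in>K. complex_of_real (a k i))"
      using a(2) that by (intro diag_value_sum)
    moreover have "diag_value i (sum A K) 1"
      using diag_value_scalar[of i 1] by (simp add: sum_A)
    ultimately have "(\<Sum>k\<in>K. complex_of_real (a k i)) = 1"
      using that unfolding N_def by (rule_tac diag_value_unique)
    then have "complex_of_real (\<Sum>k\<in>K. a k i) = 1" by simp
    then show ?thesis by (simp only: of_real_eq_1_iff)
  qed
  \<comment> \<open>Contractivity of the characters bounds the difference in each entry by
    \<open>norm (level.diag j (f k) - A k)\<close>.\<close>
  have fa: "norm (level.diag j (\<lambda>i. complex_of_real (a k i)) - level.diag j (f k)) \<le> \<delta>"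
    if k: "k \<in> K" for k
    unfolding level.diag_diff[symmetric]
  proof (rule level.norm_diag_le)
    fix i assume i: "i < n j"
    have "diag_value i (level.diag j (f k) - A k) (f k i - a k i)"
      using i k by (intro diag_value_diff diag_value_diag a(2)) (auto simp: N_def)
    from diag_value_norm_le[OF i this] f[OF k]
    show "cmod (complex_of_real (a k i) - f k i) \<le> \<delta>" by (simp add: norm_minus_commute)
  qed (use \<delta> in simp)

  define m where "m = card K"
  \<comment> \<open>A multiplicity \<open>d\<close> above \<open>m + B\<close> leaves room for all
    \<open>m\<close> colours and pushes the rounding error \<open>m^2 / d\<close> below
    \<open>\<delta>\<close>.\<close>
  obtain B where B: "(real m)\<^sup>2 / \<delta> < real B" using reals_Archimedean2 by blast
  obtain l0 where "N * (m + B) < n l0" using n_unbounded[OF assms(1)] by blast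
  define l where "l = max j l0"
  define d where "d = n l div N"
  have jl: "j \<le> l" by (simp add: l_def)
  have nl: "n l = d * N" using n_dvd[OF jl] by (simp add: d_def N_def)
  have "N * (m + B) < n l" using \<open>N * (m + B) < n l0\<close> n_mono[of l0 l] by (simp add: l_def)
  then have "m + B < d" by (simp add: nl mult.commute)
  then have d: "0 < d" "m \<le> d" "B < d" by auto
  have md: "(real m)\<^sup>2 / d < \<delta>"
  proof -
    have "(real m)\<^sup>2 / \<delta> < d" using B d by linarith
    then show ?thesis using \<delta> d by (simp add: field_simps)
  qed
  define good where "good i c \<longleftrightarrow> (\<forall>s<d. c s \<in> K) \<and> (\<forall>k\<in>K. 0 < card {s. s < d \<and> c s = k}
      \<and> \<bar>card {s. s < d \<and> c s = k} - d * a k i\<bar> \<le> (real m)\<^sup>2)" for i c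
  have "\<exists>c. good i c" if "i < N" for i
  proof (rule colouring_with_frequencies[of K d "\<lambda>k. a k i"])
    show "finite K" "card K \<le> d" "(\<Sum>k\<in>K. a k i) = 1" "\<And>k. k \<in> K \<Longrightarrow> 0 \<le> a k i"
      using K d(2) sum_a[OF that] a(1)[OF _ that] by (auto simp: m_def)
    show "\<exists>c. good i c" if "\<And>s. s < d \<Longrightarrow> c s \<in> K"
      "\<And>k. k \<in> K \<Longrightarrow> 0 < card {s. s < d \<and> c s = k}"
      "\<And>k. k \<in> K \<Longrightarrow> \<bar>card {s. s < d \<and> c s = k} - d * a k i\<bar> \<le> (real (card K))\<^sup>2" for c
      using that by (intro exI[of _ c]) (simp add: good_def m_def)
  qed
  then obtain c where good: "good i (c i)" if "i < N" for i
    by metis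
  have c: "\<And>i s. i < N \<Longrightarrow> s < d \<Longrightarrow> c i s \<in> K"
    "\<And>i k. i < N \<Longrightarrow> k \<in> K \<Longrightarrow> 0 < card {s. s < d \<and> c i s = k}"
    "\<And>i k. i < N \<Longrightarrow> k \<in> K \<Longrightarrow> \<bar>card {s. s < d \<and> c i s = k} - d * a k i\<bar> \<le> (real m)\<^sup>2"
    using good unfolding good_def by blast+
  \<comment> \<open>Each diagonal position \<open>i\<close> of level \<open>j\<close> has its own
    colouring \<open>c i\<close> of its \<open>d\<close> copies at level \<open>l\<close>. A
    position \<open>p\<close> is copy \<open>p div N\<close> of \<open>p mod N\<close>.\<close>
  define colour where "colour p = c (p mod N) (p div N)" for p
  have colour: "colour p \<in> K" if "p < n l" for p
    using that N by (auto simp: colour_def nl less_mult_imp_div_less intro!: c(1))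
  define U where "U = fourier_blocks N d"
  have U: "U \<in> carrier_mat (n l) (n l)" "U * mat_adjoint U = 1\<^sub>m (n l)"
    by (simp_all add: U_def nl fourier_blocks_carrier fourier_blocks_unitary)
  define Q where "Q k = U * mat_diag (n l) (\<lambda>p. of_bool (colour p = k)) * mat_adjoint U" for k
  define freq where "freq k i = real (card {s. s < d \<and> c i s = k}) / d" for k i
  \<comment> \<open>Row \<open>p\<close> of \<open>U\<close> is supported on the residue class of
    \<open>p\<close>, with squared modulus \<open>1 / d\<close> at each of its \<open>d\<close>
    places.\<close>
  have Q_entry: "Q k $$ (p, p) = freq k (p mod N)" if p: "p < n l" for k p
  proof -
    have "Q k $$ (p, p) =
        (\<Sum>q<n l. of_bool (colour q = k) * of_real ((cmod (U $$ (p, q)))\<^sup>2))"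
      unfolding Q_def by (rule level.coloured_diagonal_entry[OF U p])
    also have "\<dots> = (\<Sum>q<d * N. if q mod N = p mod N
        then of_bool (c (p mod N) (q div N) = k) / complex_of_nat d else 0)"
      using p by (intro sum.cong)
        (auto simp: nl U_def fourier_blocks_cmod colour_def simp del: of_real_power)
    also have "\<dots> = (\<Sum>s<d. of_bool (c (p mod N) s = k) / complex_of_nat d)"
      using N by (intro sum_residue_class) auto
    also have "\<dots> = of_nat (card ({..<d} \<inter> {s. c (p mod N) s = k})) / complex_of_nat d"
      by (simp flip: sum_divide_distrib)
    also have "{..<d} \<inter> {s. c (p mod N) s = k} = {s. s < d \<and> c (p mod N) s = k}" by auto
    finally show ?thesis by (simp add: freq_def)
  qed
  \<comment> \<open>The diagonal entries depend only on \<open>p mod N\<close>, so the expectation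
    falls back to level \<open>j\<close>, where it can be compared with \<open>a k\<close>.\<close>
  have EQ: "E (\<phi> l (Q k)) = level.diag j (\<lambda>i. complex_of_real (freq k i))" for k
  proof -
    have Qk: "Q k \<in> carrier_mat (n l) (n l)"
      unfolding Q_def by (rule level.coloured_carrier[OF U])
    then have "E (\<phi> l (Q k)) = level.diag l (\<lambda>p. Q k $$ (p, p))"
      using E by (simp add: uhf_expectation_def diag_part_eq_mat_diag level.diag_def)
    also have "\<dots> = level.diag l (\<lambda>p. complex_of_real (freq k (p mod n j)))"
      by (intro level.diag_cong) (simp add: Q_entry N_def)
    finally show ?thesis using diag_lift[OF jl] by simp
  qed
  show thesis
  proof (rule that[of "\<lambda>k. \<phi> l (Q k)"])
    fix k assume k: "k \<in> K"
    \<comment> \<open>A single occurrence of the colour is enough. Residue class 0 exists because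
      \<open>N > 0\<close>, and its copy \<open>s\<close> sits at position
      \<open>s * N\<close>.\<close>
    obtain s where s: "s < d" "c 0 s = k"
      using c(2)[OF N k] by (auto simp: card_gt_0_iff)
    have "s * N < n l" "colour (s * N) = k"
      using s N by (auto simp: nl colour_def)
    then have "\<phi> l (Q k) \<noteq> 0"
      unfolding Q_def by (intro level.coloured_nonzero[OF U])
    moreover have "projection (\<phi> l (Q k))"
      unfolding Q_def by (rule level.projection_coloured[OF U])
    ultimately show "projection (\<phi> l (Q k)) \<and> \<phi> l (Q k) \<noteq> 0" by blast
    have "norm (level.diag j (\<lambda>i. complex_of_real (freq k i))
        - level.diag j (\<lambda>i. complex_of_real (a k i))) \<le> \<delta>"
      unfolding level.diag_diff[symmetric]
    proof (rule level.norm_diag_le)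
      fix i assume "i < n j"
      then have "\<bar>card {s. s < d \<and> c i s = k} - d * a k i\<bar> / d \<le> (real m)\<^sup>2 / d"
        using c(3)[of i k] k by (intro divide_right_mono) (auto simp: N_def)
      moreover have "\<bar>card {s. s < d \<and> c i s = k} - d * a k i\<bar> / d = \<bar>freq k i - a k i\<bar>"
      proof -
        have "freq k i - a k i = (card {s. s < d \<and> c i s = k} - d * a k i) / d"
          using d(1) by (simp add: freq_def diff_divide_distrib)
        then show ?thesis by simp
      qed
      ultimately have "\<bar>freq k i - a k i\<bar> \<le> \<delta>" using md by simp
      then show "cmod (complex_of_real (freq k i) - complex_of_real (a k i)) \<le> \<delta>"
        by (simp flip: of_real_diff)
    qed (use \<delta> in simp)
    then have "norm (E (\<phi> l (Q k)) - A k) \<le> \<delta> + \<delta> + \<delta>"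
      unfolding EQ using fa[OF k] f[OF k]
      by (smt (verit) norm_triangle_ineq diff_add_cancel add_diff_eq)
    then show "norm (E (\<phi> l (Q k)) - A k) < \<epsilon>" using \<open>\<epsilon> > 0\<close> by (simp add: \<delta>_def)
  next
    show "\<phi> l (Q k) * \<phi> l (Q k') = 0" if "k \<noteq> k'" for k k'
      unfolding Q_def using that by (rule level.coloured_orthogonal[OF U])
    show "(\<Sum>k\<in>K. \<phi> l (Q k)) = 1"
      unfolding Q_def using K colour by (rule level.sum_coloured[OF U])
  qed
qed

end

theorem theorem3p19:
  fixes n :: "nat \<Rightarrow> nat"
    and \<phi> :: "nat \<Rightarrow> complex mat \<Rightarrow> 'a::unital_cstar_algebra"
    and E :: "'a \<Rightarrow> 'a"
    and m :: nat
    and A :: "nat \<Rightarrow> 'a"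
    and \<epsilon> :: real
  assumes "uhf_system n \<phi>"
    and "\<not> is_matrix_algebra TYPE('a)"
    and "uhf_expectation n \<phi> E"
    and "partition_of_unity (uhf_diagonal n \<phi>) m A"
    and "\<epsilon> > 0"
  shows "\<exists>P :: nat \<Rightarrow> 'a.
           (\<forall>k\<in>{1..m}. projection (P k) \<and> P k \<noteq> 0) \<and>
           (\<forall>k\<in>{1..m}. \<forall>l\<in>{1..m}. k \<noteq> l \<longrightarrow> P k * P l = 0) \<and>
           (\<Sum>k=1..m. P k) = 1 \<and>
           (\<forall>k\<in>{1..m}. norm (E (P k) - A k) < \<epsilon>)"
proof -
  interpret uhf n \<phi> by unfold_locales fact
  have A: "A k \<in> uhf_diagonal n \<phi>" "cstar_positive (A k)" if "k \<in> {1..m}" for k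
    using assms(4) that by (auto simp: partition_of_unity_def cstar_le_def)
  have "(\<Sum>k=1..m. A k) = 1"
    using assms(4) by (simp add: partition_of_unity_def)
  from partition_approximated_by_projections[OF assms(2,3) finite_atLeastAtMost A this assms(5)]
  obtain P where "\<And>k. k \<in> {1..m} \<Longrightarrow> projection (P k) \<and> P k \<noteq> 0"
    "\<And>k l. k \<noteq> l \<Longrightarrow> P k * P l = 0" "(\<Sum>k=1..m. P k) = 1"
    "\<And>k. k \<in> {1..m} \<Longrightarrow> norm (E (P k) - A k) < \<epsilon>"
    by metis
  then show ?thesis by blast
qed

end
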